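(* Let $p$ be a projection in $M_n$ with minimal block decomposition $p=\sum_{j=1}^{s}pf_j$. For every diagonal matrix $d\in D_n$, the following assertions are equivalent: (i) $d$ belongs to $E(p+pM_np^\perp)=\{E(p+pxp^\perp): x\in M_n\}$; (ii) $\mathrm{Tr}(df_j)=\mathrm{rank}(pf_j)$ for $j=1,\ldots,s$.
   Context: $M_n$ denotes the $n\times n$ matrices over a fixed field which is either $\mathbb{R}$ or $\mathbb{C}$ (the result holds for both), $D_n$ the diagonal matrices, and $E\colon M_n\to D_n$ the linear map that keeps the diagonal entries and replaces all off-diagonal entries by $0$. A projection is a matrix $p=p^*=p^2$, and $p^\perp=\mathrm{id}-p$. The set $p+pM_np^\perp$ is exactly the set of idempotents in $M_n$ with the same range as $p$. Minimal block decomposition of $x\in M_n$: let $e_i$ be the rank-one diagonal projection onto the $i$-th standard basis vector, and let $\stackrel{x}{\sim}$ be the smallest equivalence relation on $\{1,\dots,n\}$ such that $i\stackrel{x}{\sim}j$ whenever $e_ixe_j\neq 0$. For each equivalence class, sum the $e_i$ over the class; this gives mutually orthogonal diagonal projections $f_1,\dots,f_s$ with $\sum_j f_j=\mathrm{id}$, each commuting with $x$, and $x=\sum_j xf_j$ is the minimal block decomposition of $x$. (The $f_j$ are the minimal projections of $\{x\}'\cap D_n$, where $\{x\}'$ is the commutant of $x$, when $x$ is self-adjoint.) *)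

theory Defs
  imports "HOL-Analysis.Analysis" "Jordan_Normal_Form.Conjugate"
begin

(* The definitions are generic in the entry field; conjugate is the identity on real
   and cnj on complex. *)

definition conj_transpose :: "'a::conjugatable_field^'n^'m \<Rightarrow> 'a^'m^'n" where
  "conj_transpose A = (\<chi> i j. conjugate (A $ j $ i))"

definition is_projection :: "'a::conjugatable_field^'n^'n \<Rightarrow> bool" where
  "is_projection p \<longleftrightarrow> p = conj_transpose p \<and> p = p ** p"

definition perp :: "'a::field^'n^'n \<Rightarrow> 'a^'n^'n" where
  "perp p = mat 1 - p"

definition diagonal_matrices :: "('a::field^'n^'n) set" where
  "diagonal_matrices = {d. \<forall>i j. i \<noteq> j \<longrightarrow> d $ i $ j = 0}"

definition diag_part :: "'a::field^'n^'n \<Rightarrow> 'a^'n^'n" where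
  "diag_part A = (\<chi> i j. if i = j then A $ i $ j else 0)"

definition basis_projection :: "'n \<Rightarrow> 'a::field^'n^'n" where
  "basis_projection k = (\<chi> i j. if i = k \<and> j = k then 1 else 0)"

definition block_rel :: "'a::field^'n^'n \<Rightarrow> ('n \<times> 'n) set" where
  "block_rel x = \<Inter>{R. equiv UNIV R \<and>
     (\<forall>i j. basis_projection i ** x ** basis_projection j \<noteq> 0 \<longrightarrow> (i, j) \<in> R)}"

(* This intersection is itself one of the relations intersected, so it is the smallest one. *)
lemma equiv_block_rel: "equiv UNIV (block_rel x)"
proof (rule equivI)
  show "refl (block_rel x)"
    unfolding block_rel_def refl_on_def equiv_def by blast
  show "sym (block_rel x)"
    unfolding block_rel_def equiv_def by (rule symI) (auto dest: symD)
  show "trans (block_rel x)"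
    unfolding block_rel_def equiv_def by (rule transI) (auto dest: transD)
qed auto

lemma block_rel_support:
  "basis_projection i ** x ** basis_projection j \<noteq> 0 \<Longrightarrow> (i, j) \<in> block_rel x"
  unfolding block_rel_def by blast

(* The set {f_1, ..., f_s} of the minimal block decomposition: one f_j for each class. *)
definition block_projections :: "'a::field^'n^'n \<Rightarrow> ('a^'n^'n) set" where
  "block_projections x = (\<lambda>C. \<Sum>i\<in>C. basis_projection i) ` (UNIV // block_rel x)"

end

theory Submission
  imports Defs
begin

text \<open>
  Replacing \<open>x\<close> by a diagonal matrix with entries \<open>y\<^sub>k\<close>, the \<open>i\<close>-th diagonal entry of
  \<open>p x p\<^sup>\<bottom>\<close> becomes \<open>\<Sum>\<^sub>k \<bar>p\<^sub>i\<^sub>k\<bar>\<^sup>2 (y\<^sub>i - y\<^sub>k)\<close>, because \<open>p = p p\<^sup>*\<close>. This is the Laplacian of the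
  graph on the indices with edge weights \<open>\<bar>p\<^sub>i\<^sub>k\<bar>\<^sup>2\<close>, whose connected components are the blocks
  of \<open>p\<close>; its range consists of all vectors whose entries sum to zero over every component.
  Conversely \<open>p x p\<^sup>\<bottom>\<close> has trace zero on each block since \<open>p\<close> commutes with \<open>f\<^sub>j\<close>, and the rank of
  the idempotent \<open>p f\<^sub>j\<close> is its trace.
\<close>

section \<open>Linear algebra over a field: separation from a subspace, trace of an
  idempotent\<close>

lemma matrix_mult_diff_distrib:
  fixes A :: "'a::ring_1^'n^'m"
  shows "A ** (B - C) = A ** B - A ** C" and "(D - E) ** A = D ** A - E ** A"
  by (simp_all add: matrix_matrix_mult_def vec_eq_iff right_diff_distrib left_diff_distrib
      sum_subtractf)

lemma matrix_add_rdistrib: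
  fixes A :: "'a::semiring_1^'n^'m"
  shows "(B + C) ** A = B ** A + C ** A"
  by (simp add: matrix_matrix_mult_def vec_eq_iff distrib_right sum.distrib)

text \<open>A basis of \<open>W\<close> stays independent when \<open>v\<close> is adjoined, so some
  linear map kills the basis, hence \<open>W\<close>, but not \<open>v\<close>. The functional is
  given by its coefficients \<open>c\<close>, ready for use as a vertex labelling of the
  graph.\<close>

lemma separating_functional:
  fixes v :: "'a::field^'n"
  assumes W: "vec.subspace W" and v: "v \<notin> W"
  obtains c :: "'n \<Rightarrow> 'a" where "\<And>w. w \<in> W \<Longrightarrow> (\<Sum>i\<in>UNIV. c i * w $ i) = 0"
    and "(\<Sum>i\<in>UNIV. c i * v $ i) \<noteq> 0"
proof -
  obtain B where B: "B \<subseteq> W" "vec.independent B" "W \<subseteq> vec.span B"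
    by (meson vec.basis_exists)
  have span: "vec.span B = W"
    using B W by (metis vec.span_subspace)
  then have "vec.independent (insert v B)"
    using B(2) v by (simp add: vec.independent_insertI)
  from vec.linear_independent_extend[OF this, of "\<lambda>x. if x = v then 1 else 0"]
  obtain g :: "'a^'n \<Rightarrow> 'a^'n" where g: "Vector_Spaces.linear (*s) (*s) g"
    and gB: "\<And>x. x \<in> insert v B \<Longrightarrow> g x = (if x = v then 1 else 0)"
    by blast
  have vB: "v \<notin> B" using B(1) v by blast
  have gW: "g w = 0" if "w \<in> W" for w
  proof (rule vec.linear_eq_0_on_span[OF g])
    show "w \<in> vec.span B" using that span by simp
    show "\<And>x. x \<in> B \<Longrightarrow> g x = 0" using gB vB by auto
  qed
  have mat: "g x $ k = (\<Sum>i\<in>UNIV. matrix g $ k $ i * x $ i)" for x k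
    using arg_cong[OF matrix_works[OF g, of x], of "\<lambda>z. z $ k"]
    by (simp add: matrix_vector_mult_def)
  show thesis
  \<comment> \<open>The value of \<open>g\<close> at \<open>v\<close> is the all-ones vector, so any
    row of the matrix of \<open>g\<close> will do; \<open>undefined\<close> is merely some
    index.\<close>
  proof (rule that[of "\<lambda>i. matrix g $ undefined $ i"])
    show "(\<Sum>i\<in>UNIV. matrix g $ undefined $ i * w $ i) = 0" if "w \<in> W" for w
      using gW[OF that] mat[of w undefined] by simp
    show "(\<Sum>i\<in>UNIV. matrix g $ undefined $ i * v $ i) \<noteq> 0"
      using gB[of v] mat[of v undefined] by simp
  qed
qed

text \<open>Expanding the rows of \<open>q\<close> in a basis \<open>B\<close> of the row space
  factors \<open>q\<close> as coefficients times basis. Since \<open>q\<close> fixes its row space,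
  the product in the reverse order is the identity of size \<open>card B\<close>, and both products
  have the same trace.\<close>

lemma trace_idempotent:
  fixes q :: "'a::field^'n^'n"
  assumes q: "q ** q = q"
  shows "trace q = of_nat (rank q)"
proof -
  obtain B where B: "B \<subseteq> rows q" "vec.independent B" "rows q \<subseteq> vec.span B"
      "card B = vec.dim (rows q)"
    by (meson vec.basis_exists)
  have fin: "finite B" using B(2) by (rule vec.finiteI_independent)
  have row: "q $ i \<in> vec.span B" for i
    using B(3) by (force simp: rows_def row_def vec_lambda_eta)
  let ?r = "vec.representation B"
  have rowsum: "(\<Sum>b\<in>B. ?r (q $ i) b *s b) = q $ i" for i
    using vec.sum_representation_eq[OF B(2) row fin] by simp
  have entry: "(\<Sum>b\<in>B. ?r (q $ i) b * b $ i) = q $ i $ i" for i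
    using arg_cong[OF rowsum[of i], of "\<lambda>x. x $ i"] by simp
  \<comment> \<open>The left side is the row vector \<open>b\<close> times \<open>q\<close>.
    Choosing \<open>B\<close> among the rows of \<open>q\<close> reduces this to
    \<open>q ** q = q\<close>.\<close>
  have fix_row: "(\<Sum>i\<in>UNIV. b $ i *s q $ i) = b" if "b \<in> B" for b
  proof -
    from that B(1) obtain k where "b = q $ k"
      by (auto simp: rows_def row_def vec_lambda_eta)
    moreover have "(\<Sum>i\<in>UNIV. q $ k $ i *s q $ i) = (q ** q) $ k"
      by (simp add: vec_eq_iff matrix_matrix_mult_def)
    ultimately show ?thesis using q by simp
  qed
  have diag: "(\<Sum>i\<in>UNIV. b $ i * ?r (q $ i) b) = 1" if "b \<in> B" for b
  proof -
    have "(\<Sum>i\<in>UNIV. b $ i * ?r (q $ i) b) = (\<Sum>i\<in>UNIV. ?r (b $ i *s q $ i) b)"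
      by (simp add: vec.representation_scale[OF B(2) row])
    also have "\<dots> = ?r (\<Sum>i\<in>UNIV. b $ i *s q $ i) b"
      by (simp add: vec.representation_sum[OF B(2)] row vec.span_scale)
    also have "\<dots> = 1"
      using fix_row[OF that] vec.representation_basis[OF B(2) that] by simp
    finally show ?thesis .
  qed
  have "trace q = (\<Sum>i\<in>UNIV. \<Sum>b\<in>B. ?r (q $ i) b * b $ i)"
    by (simp add: trace_def entry)
  also have "\<dots> = (\<Sum>b\<in>B. \<Sum>i\<in>UNIV. b $ i * ?r (q $ i) b)"
    by (subst sum.swap) (simp add: mult.commute)
  also have "\<dots> = of_nat (card B)"
    by (simp add: diag)
  finally show ?thesis by (simp add: B(4) row_rank_def_gen)
qed

section \<open>Blocks of a matrix and their projections\<close>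

lemma basis_projection_sandwich:
  fixes x :: "'a::field^'n^'n"
  shows "basis_projection i ** x ** basis_projection j =
    (\<chi> a b. if a = i \<and> b = j then x $ i $ j else 0)"
  unfolding basis_projection_def matrix_matrix_mult_def vec_eq_iff
  by (auto simp: if_distrib[of "\<lambda>z. z * _"] if_distrib[of "\<lambda>z. _ * z"]
      sum.delta sum.delta' if_distribR cong: if_cong)

lemma block_rel_nonzero:
  assumes "x $ i $ j \<noteq> 0"
  shows "(i, j) \<in> block_rel x"
  using assms by (intro block_rel_support) (auto simp: basis_projection_sandwich vec_eq_iff)

text \<open>Having equal values under \<open>g\<close> is an equivalence relation that contains the
  support of \<open>x\<close>, so it contains the smallest such relation.\<close>

lemma block_rel_invariant:
  assumes "\<And>i j. x $ i $ j \<noteq> 0 \<Longrightarrow> g i = g j" and "(i, j) \<in> block_rel x"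
  shows "g i = g j"
proof -
  have "equiv UNIV {(i, j). g i = g j}"
    by (auto simp: equiv_def refl_on_def sym_def trans_def)
  then have "block_rel x \<subseteq> {(i, j). g i = g j}"
    unfolding block_rel_def
    by (intro Inter_lower) (auto simp: basis_projection_sandwich vec_eq_iff intro!: assms(1)
        split: if_splits)
  then show ?thesis using assms(2) by auto
qed

lemma sum_basis_projection:
  fixes C :: "'n::finite set"
  shows "(\<Sum>i\<in>C. basis_projection i) =
    (\<chi> a b. if a = b \<and> a \<in> C then 1 else (0 :: 'a::field))"
proof -
  have "(\<Sum>i\<in>C. if a = i \<and> b = i then 1 else (0 :: 'a)) = (if a = b \<and> a \<in> C then 1 else 0)" for a b
  proof (cases "a = b")
    case True
    then show ?thesis by simp
  next
    case False
    then show ?thesis by (auto intro: sum.neutral)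
  qed
  then show ?thesis by (simp add: vec_eq_iff basis_projection_def)
qed

lemma mult_sum_basis_projection:
  fixes A :: "'a::field^'n^'n"
  shows "A ** (\<Sum>i\<in>C. basis_projection i) = (\<chi> a b. if b \<in> C then A $ a $ b else 0)"
    and "(\<Sum>i\<in>C. basis_projection i) ** A = (\<chi> a b. if a \<in> C then A $ a $ b else 0)"
proof -
  have "(\<Sum>k\<in>UNIV. A $ a $ k * (if k = b \<and> k \<in> C then 1 else 0)) =
      (\<Sum>k\<in>UNIV. if k = b then if b \<in> C then A $ a $ b else 0 else 0)" for a b
    by (rule sum.cong) auto
  then show "A ** (\<Sum>i\<in>C. basis_projection i) = (\<chi> a b. if b \<in> C then A $ a $ b else 0)"
    by (simp add: sum_basis_projection matrix_matrix_mult_def vec_eq_iff)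
  have "(\<Sum>k\<in>UNIV. (if a = k \<and> a \<in> C then 1 else 0) * A $ k $ b) =
      (\<Sum>k\<in>UNIV. if k = a then if a \<in> C then A $ a $ b else 0 else 0)" for a b
    by (rule sum.cong) auto
  then show "(\<Sum>i\<in>C. basis_projection i) ** A = (\<chi> a b. if a \<in> C then A $ a $ b else 0)"
    by (simp add: sum_basis_projection matrix_matrix_mult_def vec_eq_iff)
qed

lemma trace_mult_sum_basis_projection:
  fixes A :: "'a::field^'n^'n"
  shows "trace (A ** (\<Sum>i\<in>C. basis_projection i)) = (\<Sum>i\<in>C. A $ i $ i)"
  by (simp add: mult_sum_basis_projection trace_def sum.If_cases)

text \<open>A nonzero entry of \<open>x\<close> has its row and column index in the same class, so
  cutting down the rows to \<open>C\<close> has the same effect as cutting down the columns.\<close>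

lemma block_projection_commute:
  assumes "f \<in> block_projections x"
  shows "f ** x = x ** f"
proof -
  from assms obtain C where C: "C \<in> UNIV // block_rel x"
    and f: "f = (\<Sum>i\<in>C. basis_projection i)"
    unfolding block_projections_def by blast
  have "a \<in> C \<longleftrightarrow> b \<in> C" if "x $ a $ b \<noteq> 0" for a b
    using C block_rel_nonzero[OF that] equiv_block_rel[of x]
    by (meson equiv_def in_quotient_imp_closed symD)
  then show ?thesis
    unfolding f mult_sum_basis_projection by (auto simp: vec_eq_iff)
qed

lemma block_projection_idem:
  assumes "f \<in> block_projections x"
  shows "f ** f = f"
proof -
  from assms obtain C where f: "f = (\<Sum>i\<in>C. basis_projection i)"
    unfolding block_projections_def by blast
  show ?thesis
    unfolding f mult_sum_basis_projection(1) by (auto simp: sum_basis_projection vec_eq_iff)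
qed

lemma trace_compression_block:
  fixes p :: "'a::field^'n^'n"
  assumes p: "p ** p = p" and f: "f \<in> block_projections p"
  shows "trace ((p + p ** x ** perp p) ** f) = of_nat (rank (p ** f))"
proof -
  have comm: "f ** p = p ** f" by (rule block_projection_commute[OF f])
  have "(p ** f) ** (p ** f) = p ** (f ** p) ** f"
    by (simp only: matrix_mul_assoc)
  also have "\<dots> = (p ** p) ** (f ** f)"
    by (simp only: matrix_mul_assoc comm)
  also have "\<dots> = p ** f"
    by (simp only: p block_projection_idem[OF f])
  finally have 1: "trace (p ** f) = of_nat (rank (p ** f))"
    by (rule trace_idempotent)
  \<comment> \<open>Cyclicity of the trace will carry the leading \<open>p\<close> of
    \<open>p ** x ** perp p ** f\<close> to the far right; commuting with \<open>f\<close>, it then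
    meets \<open>perp p\<close> and the product vanishes.\<close>
  have "perp p ** f ** p = perp p ** (p ** f)"
    by (simp only: comm matrix_mul_assoc[symmetric])
  also have "\<dots> = (perp p ** p) ** f"
    by (simp only: matrix_mul_assoc)
  also have "perp p ** p = 0"
    by (simp add: perp_def p matrix_mult_diff_distrib)
  finally have "perp p ** f ** p = 0" by simp
  then have "trace (x ** (perp p ** f ** p)) = 0"
    by (simp add: trace_def)
  then have 2: "trace (p ** x ** perp p ** f) = 0"
    using trace_mul_sym[of p "x ** (perp p ** f)"] by (simp add: matrix_mul_assoc)
  show ?thesis
    by (simp add: matrix_add_rdistrib trace_add 1 2)
qed

section \<open>Kernel and range of the weighted graph Laplacian\<close>

text \<open>A functional \<open>c\<close> that annihilates the range of the Laplacian has zero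
  Dirichlet energy, so \<open>c\<close> agrees at the two ends of every edge and therefore
  throughout each component.\<close>

lemma laplacian_kernel:
  fixes p :: "'a::conjugatable_ordered_field^'n^'n"
  assumes p: "p = conj_transpose p"
    and c: "\<And>y. (\<Sum>i\<in>UNIV. c i * (\<Sum>k\<in>UNIV. p $ i $ k * p $ k $ i * (y i - y k))) = 0"
    and ij: "(i, j) \<in> block_rel p"
  shows "c i = c j"
proof -
  have conj: "p $ k $ i = conjugate (p $ i $ k)" for i k
    using arg_cong[OF p, of "\<lambda>A. A $ k $ i"] by (simp add: conj_transpose_def)
  \<comment> \<open>With this choice the hypothesis \<open>c\<close> becomes the vanishing of the
    Hermitian quadratic form of the Laplacian.\<close>
  define y where "y i = conjugate (c i)" for i
  have conj_diff: "conjugate (a - b) = conjugate a - conjugate b" for a b :: 'a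
    using conjugate_dist_add[of a "- b"] by (simp add: conjugate_neg)
  let ?t = "\<lambda>i k. p $ i $ k * (c i - c k)"
  let ?s = "\<lambda>i k. c i * (p $ i $ k * p $ k $ i * (y i - y k))"
  have s: "(\<Sum>i\<in>UNIV. \<Sum>k\<in>UNIV. ?s i k) = 0"
    using c[of y] by (simp add: sum_distrib_left)
  then have s': "(\<Sum>i\<in>UNIV. \<Sum>k\<in>UNIV. ?s k i) = 0"
    by (subst sum.swap)
  \<comment> \<open>Swapping the indices keeps the weight and negates the difference of the
    \<open>y\<close>, so the two terms combine into a squared modulus. Summed, these nonnegative
    terms give zero, hence each is zero.\<close>
  have "?t i k * conjugate (?t i k) = ?s i k + ?s k i" for i k
    unfolding conjugate_dist_mul conj_diff conj[symmetric] y_def by (simp add: algebra_simps)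
  then have "(\<Sum>i\<in>UNIV. \<Sum>k\<in>UNIV. ?t i k * conjugate (?t i k)) = 0"
    using s s' by (simp add: sum.distrib)
  then have "?t i k * conjugate (?t i k) = 0" for i k
    by (simp add: sum_nonneg_eq_0_iff sum_nonneg conjugate_square_positive del: mult_eq_0_iff)
  then have "?t i k = 0" for i k
    using conjugate_square_0 by blast
  then show ?thesis
    using block_rel_invariant[of p c, OF _ ij] by (metis mult_eq_0_iff right_minus_eq)
qed

text \<open>If \<open>v\<close> were outside the range, a functional would vanish on the range but
  not at \<open>v\<close>. By \<open>laplacian_kernel\<close> it is constant on each class, and then
  the zero class sums of \<open>v\<close> force it to vanish at \<open>v\<close> too.\<close>

lemma laplacian_range:
  fixes p :: "'a::conjugatable_ordered_field^'n^'n"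
  assumes p: "p = conj_transpose p"
    and v: "\<And>C. C \<in> UNIV // block_rel p \<Longrightarrow> (\<Sum>i\<in>C. v $ i) = 0"
  obtains y where "\<And>i. v $ i = (\<Sum>k\<in>UNIV. p $ i $ k * p $ k $ i * (y $ i - y $ k))"
proof -
  define L :: "'a^'n \<Rightarrow> 'a^'n"
    where "L y = (\<chi> i. \<Sum>k\<in>UNIV. p $ i $ k * p $ k $ i * (y $ i - y $ k))" for y
  have "Vector_Spaces.linear (*s) (*s) L"
    by unfold_locales
      (simp_all add: L_def vec_eq_iff sum.distrib[symmetric] sum_distrib_left algebra_simps)
  then have sub: "vec.subspace (range L)"
    using vec.linear_subspace_image vec.subspace_UNIV by blast
  have "v \<in> range L"
  proof (rule ccontr)
    assume "v \<notin> range L"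
    from separating_functional[OF sub this] obtain c
      where c: "\<And>w. w \<in> range L \<Longrightarrow> (\<Sum>i\<in>UNIV. c i * w $ i) = 0"
        and cv: "(\<Sum>i\<in>UNIV. c i * v $ i) \<noteq> 0" by metis
    have "(\<Sum>i\<in>UNIV. c i * (\<Sum>k\<in>UNIV. p $ i $ k * p $ k $ i * (y i - y k))) = 0" for y
      using c[OF rangeI[of L "\<chi> i. y i"]] by (simp add: L_def)
    note const = laplacian_kernel[OF p this]
    have "(\<Sum>i\<in>C. c i * v $ i) = 0" if C: "C \<in> UNIV // block_rel p" for C
    proof -
      from C obtain j where "C = block_rel p `` {j}" by (auto elim: quotientE)
      then have "(\<Sum>i\<in>C. c i * v $ i) = (\<Sum>i\<in>C. c j * v $ i)"
        using const by (intro sum.cong) auto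
      then show ?thesis by (simp add: sum_distrib_left[symmetric] v[OF C])
    qed
    moreover have "(\<Sum>i\<in>UNIV. c i * v $ i) =
        (\<Sum>C\<in>UNIV // block_rel p. \<Sum>i\<in>C. c i * v $ i)"
      using sum.Union_disjoint[of "UNIV // block_rel p" "\<lambda>i. c i * v $ i"]
        Union_quotient[OF equiv_block_rel[of p]] quotient_disj[OF equiv_block_rel[of p]]
      by (metis (no_types, lifting) comp_apply finite sum.cong)
    ultimately show False using cv by simp
  qed
  then show thesis using that by (auto simp: L_def)
qed

section \<open>Diagonal of the compression, and the equivalence\<close>

text \<open>The matrix is \<open>p ** D - p ** D ** p\<close> with \<open>D\<close> the diagonal
  matrix of \<open>y\<close>. Expanding \<open>p $ i $ i\<close> through \<open>p = p ** p\<close>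
  puts both terms over the same products \<open>p $ i $ k * p $ k $ i\<close>, leaving the
  differences of \<open>y\<close>.\<close>

lemma diag_compression_diagonal:
  fixes p :: "'a::field^'n^'n"
  assumes p: "p ** p = p"
  shows "(p ** (\<chi> i j. if i = j then y $ i else 0) ** perp p) $ i $ i =
    (\<Sum>k\<in>UNIV. p $ i $ k * p $ k $ i * (y $ i - y $ k))"
proof -
  let ?D = "\<chi> i j. if i = j then y $ i else 0"
  have D: "(p ** ?D) $ a $ b = p $ a $ b * y $ b" for a b
  proof -
    have "(p ** ?D) $ a $ b = (\<Sum>k\<in>UNIV. if k = b then p $ a $ b * y $ b else 0)"
      by (simp add: matrix_matrix_mult_def if_distrib cong: if_cong)
    then show ?thesis by simp
  qed
  have "p ** ?D ** perp p = p ** ?D - p ** ?D ** p"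
    by (simp add: perp_def matrix_mult_diff_distrib)
  then have "(p ** ?D ** perp p) $ i $ i = p $ i $ i * y $ i - (p ** ?D ** p) $ i $ i"
    by (simp add: D)
  also have "p $ i $ i = (\<Sum>k\<in>UNIV. p $ i $ k * p $ k $ i)"
    using arg_cong[OF p, of "\<lambda>A. A $ i $ i"] by (simp add: matrix_matrix_mult_def)
  also have "(p ** ?D ** p) $ i $ i = (\<Sum>k\<in>UNIV. p $ i $ k * y $ k * p $ k $ i)"
    by (subst matrix_matrix_mult_def) (simp add: D)
  also have "(\<Sum>k\<in>UNIV. p $ i $ k * p $ k $ i) * y $ i - (\<Sum>k\<in>UNIV. p $ i $ k * y $ k * p $ k $ i) =
      (\<Sum>k\<in>UNIV. p $ i $ k * p $ k $ i * (y $ i - y $ k))"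
    unfolding sum_distrib_right sum_subtractf[symmetric]
    by (rule sum.cong) (simp_all add: algebra_simps)
  finally show ?thesis .
qed

lemma trace_diag_part_mult:
  "trace (diag_part A ** (\<Sum>i\<in>C. basis_projection i)) = trace (A ** (\<Sum>i\<in>C. basis_projection i))"
  by (simp add: trace_mult_sum_basis_projection diag_part_def)

text \<open>The sort \<open>conjugatable_ordered_field\<close> covers the real and the complex
  numbers, so one argument serves both halves of the theorem.\<close>

lemma diag_part_idempotents_iff:
  fixes p d :: "'a::conjugatable_ordered_field^'n^'n"
  assumes p: "is_projection p" and d: "d \<in> diagonal_matrices"
  shows "d \<in> diag_part ` {p + p ** x ** perp p | x. x \<in> UNIV} \<longleftrightarrow>
    (\<forall>f \<in> block_projections p. trace (d ** f) = of_nat (rank (p ** f)))"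
proof -
  have idem: "p ** p = p" and herm: "p = conj_transpose p"
    using p by (auto simp: is_projection_def)
  show ?thesis
  proof
    assume "d \<in> diag_part ` {p + p ** x ** perp p | x. x \<in> UNIV}"
    then obtain x where x: "d = diag_part (p + p ** x ** perp p)" by blast
    show "\<forall>f \<in> block_projections p. trace (d ** f) = of_nat (rank (p ** f))"
    proof
      fix f assume f: "f \<in> block_projections p"
      then have "trace (d ** f) = trace ((p + p ** x ** perp p) ** f)"
        unfolding x block_projections_def by (auto simp: trace_diag_part_mult)
      then show "trace (d ** f) = of_nat (rank (p ** f))"
        using trace_compression_block[OF idem f] by simp
    qed
  next
    assume tr: "\<forall>f \<in> block_projections p. trace (d ** f) = of_nat (rank (p ** f))"
    have "(\<Sum>i\<in>C. (\<chi> i. d $ i $ i - p $ i $ i) $ i) = 0" if "C \<in> UNIV // block_rel p" for C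
    proof -
      let ?f = "\<Sum>i\<in>C. basis_projection i :: 'a^'n^'n"
      have f: "?f \<in> block_projections p"
        using that unfolding block_projections_def by blast
      \<comment> \<open>The case \<open>x = 0\<close> of \<open>trace_compression_block\<close>
        turns the rank into a trace, so that the trace condition says that the diagonal of
        \<open>d - p\<close> sums to zero over \<open>C\<close>.\<close>
      have "trace (d ** ?f) = trace (p ** ?f)"
        using tr f trace_compression_block[OF idem f, of 0] by simp
      then show ?thesis
        by (simp add: trace_mult_sum_basis_projection sum_subtractf)
    qed
    from laplacian_range[OF herm this] obtain y :: "'a^'n"
      where "\<And>i. (\<chi> i. d $ i $ i - p $ i $ i) $ i =
        (\<Sum>k\<in>UNIV. p $ i $ k * p $ k $ i * (y $ i - y $ k))"
      by blast
    then have y: "d $ i $ i - p $ i $ i =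
        (\<Sum>k\<in>UNIV. p $ i $ k * p $ k $ i * (y $ i - y $ k))" for i
      by simp
    \<comment> \<open>The Laplacian preimage \<open>y\<close> of the diagonal of
      \<open>d - p\<close>, placed on a diagonal, is the required \<open>x\<close>.\<close>
    let ?D = "\<chi> i j. if i = j then y $ i else 0"
    have "d $ i $ i = (p + p ** ?D ** perp p) $ i $ i" for i
      using y[of i] diag_compression_diagonal[OF idem, of y i] by (simp add: algebra_simps)
    then have "d = diag_part (p + p ** ?D ** perp p)"
      using d by (simp add: diag_part_def diagonal_matrices_def vec_eq_iff)
    then show "d \<in> diag_part ` {p + p ** x ** perp p | x. x \<in> UNIV}" by blast
  qed
qed

theorem theorem6p3:
  shows
    "(\<forall>p d :: real^'n^'n. is_projection p \<longrightarrow> d \<in> diagonal_matrices \<longrightarrow>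
        (d \<in> diag_part ` {p + p ** x ** perp p | x. x \<in> UNIV}
          \<longleftrightarrow> (\<forall>f \<in> block_projections p. trace (d ** f) = of_nat (rank (p ** f)))))
   \<and> (\<forall>p d :: complex^'n^'n. is_projection p \<longrightarrow> d \<in> diagonal_matrices \<longrightarrow>
        (d \<in> diag_part ` {p + p ** x ** perp p | x. x \<in> UNIV}
          \<longleftrightarrow> (\<forall>f \<in> block_projections p. trace (d ** f) = of_nat (rank (p ** f)))))"
  by (intro conjI allI impI diag_part_idempotents_iff)

end
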